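(* Consider the decomposed system and the DD-LSPG reduced-order model described in the context, in either the interior/boundary-bases case (with trial subspace $\mathcal S=\mathcal S_{\text{I/B}}$) or the full-subdomain-bases case (with trial subspace $\mathcal S=\mathcal S_{\text F}$). Assume: (A1) strong constraints are employed, i.e. $\boldsymbol A_i=\bar{\boldsymbol A}_i$ for $i=1,\dots,n_\Omega$; (A2) there exists $\kappa_\ell>0$ such that for all $\boldsymbol w,\boldsymbol y\in\mathbb R^n$ $$\Big(\sum_{i=1}^{n_\Omega}\|\boldsymbol r_i(\boldsymbol P_i^\Omega\boldsymbol w,\boldsymbol P_i^\Gamma\boldsymbol w)-\boldsymbol r_i(\boldsymbol P_i^\Omega\boldsymbol y,\boldsymbol P_i^\Gamma\boldsymbol y)\|_2^2\Big)^{1/2}\ \ge\ \kappa_\ell\,\|\boldsymbol w-\boldsymbol y\|_2;$$ (A3) there exists $P>0$ such that for all $\boldsymbol w\in\mathcal S$ $$\Big(\sum_{i=1}^{n_\Omega}\|\boldsymbol B_i\boldsymbol r_i(\boldsymbol P_i^\Omega\boldsymbol w,\boldsymbol P_i^\Gamma\boldsymbol w)\|_2^2\Big)^{1/2}\ \ge\ P\,\Big(\sum_{i=1}^{n_\Omega}\|\boldsymbol r_i(\boldsymbol P_i^\Omega\boldsymbol w,\boldsymbol P_i^\Gamma\boldsymbol w)\|_2^2\Big)^{1/2}.$$ Let $\boldsymbol x\in\mathbb R^n$ be the full-order solution, i.e. $\boldsymbol r(\boldsymbol x)=\boldsymbol 0$, with $\boldsymbol x_i^\Omega=\boldsymbol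 P_i^\Omega\boldsymbol x$, and let $\tilde{\boldsymbol x}\in\mathbb R^n$ be the global DD-LSPG solution, with $\tilde{\boldsymbol x}_i^\Omega=\boldsymbol P_i^\Omega\tilde{\boldsymbol x}$ and $\tilde{\boldsymbol x}_i^\Gamma=\boldsymbol P_i^\Gamma\tilde{\boldsymbol x}$. Then, for both types of bases, $$\max\Big(\max_{i\in\{1,\dots,n_\Omega\}}\|\boldsymbol x_i^\Omega-\tilde{\boldsymbol x}_i^\Omega\|_2,\ \max_{j\in\{1,\dots,n_p\}}\|\boldsymbol P^{j}\boldsymbol x-\boldsymbol P^{j}\tilde{\boldsymbol x}\|_2\Big)\ \le\ \|\boldsymbol x-\tilde{\boldsymbol x}\|_2\ \le\ \frac{1}{P\,\kappa_\ell}\Big(\sum_{i=1}^{n_\Omega}\|\boldsymbol B_i\boldsymbol r_i(\tilde{\boldsymbol x}_i^\Omega,\tilde{\boldsymbol x}_i^\Gamma)\|_2^2\Big)^{1/2}.$$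
   Context: Full-order model and algebraic decomposition. $\boldsymbol r:\mathbb R^n\to\mathbb R^n$ is a (nonlinear) residual with $$\boldsymbol r(\boldsymbol w)=\sum_{i=1}^{n_\Omega}[\boldsymbol P_i^{r}]^T\boldsymbol r_i(\boldsymbol P_i^\Omega\boldsymbol w,\boldsymbol P_i^\Gamma\boldsymbol w)\quad\text{for all }\boldsymbol w\in\mathbb R^n,$$ where $\boldsymbol r_i:\mathbb R^{n_i^\Omega}\times\mathbb R^{n_i^\Gamma}\to\mathbb R^{n_i^r}$ are subdomain residuals and $\boldsymbol P_i^r\in\{0,1\}^{n_i^r\times n}$, $\boldsymbol P_i^\Omega\in\{0,1\}^{n_i^\Omega\times n}$, $\boldsymbol P_i^\Gamma\in\{0,1\}^{n_i^\Gamma\times n}$ are sampling matrices (each consists of distinct selected rows of the $n\times n$ identity) extracting residual entries, interior states and interface states of subdomain $i$. They satisfy $\boldsymbol P_i^r[\boldsymbol P_j^r]^T=\boldsymbol 0$ and $\boldsymbol P_i^\Omega[\boldsymbol P_j^\Omega]^T=\boldsymbol 0$ for $i\ne j$, and $\sum_i n_i^r=n$. Put $n_i=n_i^\Omega+n_i^\Gamma$. Ports. There are $n_p$ ports. Port $j$ is a group of $n_j^p$ global degrees of freedom shared by a fixed set of subdomains $\mathcal P(j)\subseteq\{1,\dots,n_\Omega\}$. For $i\in\mathcal P(j)$, $\boldsymbol P_i^j\in\{0,1\}^{n_j^p\times n_i^\Gamma}$ consists of selected rows of the $n_i^\Gamma\times n_i^\Gamma$ identity and extracts the degrees of freedom of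 port $j$ from the interface state of subdomain $i$. $\boldsymbol P^j\in\{0,1\}^{n_j^p\times n}$ consists of selected rows of the $n\times n$ identity and extracts from the global state the degrees of freedom of port $j$; thus $\boldsymbol P_i^j\boldsymbol P_i^\Gamma=\boldsymbol P^j$ for every $i\in\mathcal P(j)$. For each subdomain $i$, with $\mathcal Q(i)=\{j: i\in\mathcal P(j)\}$, the ports are non-overlapping, $\boldsymbol P_i^j[\boldsymbol P_i^\ell]^T=\boldsymbol 0$ for $j\neq\ell$ in $\mathcal Q(i)$, and $\sum_{j\in\mathcal Q(i)}n_j^p=n_i^\Gamma$. The global degrees of freedom $\{1,\dots,n\}$ are partitioned into segments: one for the interior degrees of freedom of each subdomain and one for each port. Strong compatibility constraints. $\bar{\boldsymbol A}_i\in\{-1,0,1\}^{n_{\bar A}\times n_i^\Gamma}$, $i=1,\dots,n_\Omega$, with $n_{\bar A}=\sum_j(|\mathcal P(j)|-1)n_j^p$, are matrices assembled so that $\sum_i\bar{\boldsymbol A}_i\boldsymbol y_i=\boldsymbol 0$ (with $\boldsymbol y_i\in\mathbb R^{n_i^\Gamma}$) holds if and only if $\boldsymbol P_i^j\boldsymbol y_i=\boldsymbol P_\ell^j\boldsymbol y_\ell$ for all $i,\ell\in\mathcal P(j)$ and all $j$. Bases. Interior/boundary-bases case: full-column-rank matrices $\boldsymbol\Phi_i^\Omega\in\mathbb R^{n_i^\Omega\times p_i^\Omega}$ and $\boldsymbol\Phi_i^\Gamma\in\mathbb R^{n_i^\Gamma\times p_i^\Gamma}$ are given. Full-subdomain-bases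 case: a full-column-rank matrix $\boldsymbol\Phi_i\in\mathbb R^{n_i\times p_i}$ is given for each $i$, and $\boldsymbol\Phi_i^\Omega\in\mathbb R^{n_i^\Omega\times p_i}$, $\boldsymbol\Phi_i^\Gamma\in\mathbb R^{n_i^\Gamma\times p_i}$ are its blocks of rows corresponding to interior and interface degrees of freedom ($p_i^\Omega=p_i^\Gamma=p_i$; these blocks need not have full column rank individually). DD-LSPG reduced-order model. Given matrices $\boldsymbol B_i\in\mathbb R^{n_i^B\times n_i^r}$ with $n_i^B\le n_i^r$ and constraint matrices $\boldsymbol A_i\in\mathbb R^{n_A\times n_i^\Gamma}$: - interior/boundary bases: $(\hat{\boldsymbol x}_i^\Omega,\hat{\boldsymbol x}_i^\Gamma)_{i}$ is a solution of: minimize $\frac12\sum_i\|\boldsymbol B_i\boldsymbol r_i(\boldsymbol\Phi_i^\Omega\hat{\boldsymbol w}_i^\Omega,\boldsymbol\Phi_i^\Gamma\hat{\boldsymbol w}_i^\Gamma)\|_2^2$ over $(\hat{\boldsymbol w}_i^\Omega,\hat{\boldsymbol w}_i^\Gamma)_i$ subject to $\sum_i\boldsymbol A_i\boldsymbol\Phi_i^\Gamma\hat{\boldsymbol w}_i^\Gamma=\boldsymbol 0$; one sets $\tilde{\boldsymbol x}_i^\Omega=\boldsymbol\Phi_i^\Omega\hat{\boldsymbol x}_i^\Omega$, $\tilde{\boldsymbol x}_i^\Gamma=\boldsymbol\Phi_i^\Gamma\hat{\boldsymbol x}_i^\Gamma$; - full-subdomain bases: $(\hat{\boldsymbol x}_i)_i$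 is a solution of: minimize $\frac12\sum_i\|\boldsymbol B_i\boldsymbol r_i(\boldsymbol\Phi_i^\Omega\hat{\boldsymbol w}_i,\boldsymbol\Phi_i^\Gamma\hat{\boldsymbol w}_i)\|_2^2$ over $(\hat{\boldsymbol w}_i)_i$ subject to $\sum_i\boldsymbol A_i\boldsymbol\Phi_i^\Gamma\hat{\boldsymbol w}_i=\boldsymbol 0$; one sets $\tilde{\boldsymbol x}_i^\Omega=\boldsymbol\Phi_i^\Omega\hat{\boldsymbol x}_i$, $\tilde{\boldsymbol x}_i^\Gamma=\boldsymbol\Phi_i^\Gamma\hat{\boldsymbol x}_i$. When $\boldsymbol A_i=\bar{\boldsymbol A}_i$ for all $i$, the subdomain solutions agree on ports, and the global DD-LSPG solution is the vector $\tilde{\boldsymbol x}\in\mathbb R^n$ with $\boldsymbol P_i^\Omega\tilde{\boldsymbol x}=\tilde{\boldsymbol x}_i^\Omega$ and $\boldsymbol P_i^\Gamma\tilde{\boldsymbol x}=\tilde{\boldsymbol x}_i^\Gamma$ for all $i$. Trial subspaces. Let $\bar{\boldsymbol A}=[\bar{\boldsymbol A}_1\boldsymbol\Phi_1^\Gamma\ \cdots\ \bar{\boldsymbol A}_{n_\Omega}\boldsymbol\Phi_{n_\Omega}^\Gamma]$, $p^{\text{null}}=\sum_ip_i^\Gamma-\operatorname{rank}(\bar{\boldsymbol A})$, and let $\bar{\boldsymbol N}\in\mathbb R^{(\sum_ip_i^\Gamma)\times p^{\text{null}}}$ be a matrix whose columns form a basis of the null space of $\bar{\boldsymbol A}$,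 with $i$th row block $\bar{\boldsymbol N}_i\in\mathbb R^{p_i^\Gamma\times p^{\text{null}}}$. In the interior/boundary-bases case, $$\mathcal S_{\text{I/B}}=\{\boldsymbol w\in\mathbb R^n:\ \exists\,\hat{\boldsymbol w}_i^\Omega\in\mathbb R^{p_i^\Omega}\ (i=1,\dots,n_\Omega),\ \hat{\boldsymbol w}^{\text{null}}\in\mathbb R^{p^{\text{null}}}\text{ with }\boldsymbol P_i^\Omega\boldsymbol w=\boldsymbol\Phi_i^\Omega\hat{\boldsymbol w}_i^\Omega,\ \boldsymbol P_i^\Gamma\boldsymbol w=\boldsymbol\Phi_i^\Gamma\bar{\boldsymbol N}_i\hat{\boldsymbol w}^{\text{null}}\ \forall i\},$$ and in the full-subdomain-bases case, $$\mathcal S_{\text F}=\{\boldsymbol w\in\mathbb R^n:\ \exists\,\hat{\boldsymbol w}^{\text{null}}\in\mathbb R^{p^{\text{null}}}\text{ with }\boldsymbol P_i^\Omega\boldsymbol w=\boldsymbol\Phi_i^\Omega\bar{\boldsymbol N}_i\hat{\boldsymbol w}^{\text{null}},\ \boldsymbol P_i^\Gamma\boldsymbol w=\boldsymbol\Phi_i^\Gamma\bar{\boldsymbol N}_i\hat{\boldsymbol w}^{\text{null}}\ \forall i\}.$$ *)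

theory Defs
  imports
    "Jordan_Normal_Form.Matrix_Kernel"
    "Jordan_Normal_Form.DL_Rank"
    "HOL-Analysis.L2_Norm"
    "HOL-Library.Disjoint_Sets"
begin

text \<open>
  Vectors and matrices have dimensions that depend on the subdomain or port, so they are
  carrier-based. Subdomains, ports, rows and columns are numbered from 0.
\<close>

definition norm2 :: "real vec \<Rightarrow> real" where
  "norm2 v = L2_set (\<lambda>k. v $ k) {..<dim_vec v}"

text \<open>Maximum of nonnegative quantities; it is 0 over the empty set (no ports, say).\<close>

definition fin_max :: "nat set \<Rightarrow> (nat \<Rightarrow> real) \<Rightarrow> real" where
  "fin_max I f = (if I = {} then 0 else Max (f ` I))"

definition sampling_mat :: "nat \<Rightarrow> nat \<Rightarrow> real mat \<Rightarrow> bool" where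
  "sampling_mat m n M \<longleftrightarrow>
     (\<exists>s. inj_on s {..<m} \<and> s ` {..<m} \<subseteq> {..<n} \<and> M = mat\<^sub>r m n (\<lambda>k. row (1\<^sub>m n) (s k)))"

text \<open>The positions extracted by a sampling matrix.\<close>

definition sampled :: "real mat \<Rightarrow> nat set" where
  "sampled M = {l. l < dim_col M \<and> (\<exists>k < dim_row M. M $$ (k, l) = 1)}"

text \<open>
  \<open>nOm\<close> subdomains; \<open>PR i\<close>, \<open>PO i\<close>, \<open>PG i\<close> sample the residual entries, interior states
  and interface states of subdomain \<open>i\<close>, which number \<open>nR i\<close>, \<open>nO i\<close>, \<open>nG i\<close>.
\<close>

locale dd_system =
  fixes n nOm :: nat
    and nR nO nG :: "nat \<Rightarrow> nat"
    and r :: "real vec \<Rightarrow> real vec"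
    and rs :: "nat \<Rightarrow> real vec \<Rightarrow> real vec \<Rightarrow> real vec"
    and PR PO PG :: "nat \<Rightarrow> real mat"
  assumes PR_sampling: "\<And>i. i < nOm \<Longrightarrow> sampling_mat (nR i) n (PR i)"
    and PO_sampling: "\<And>i. i < nOm \<Longrightarrow> sampling_mat (nO i) n (PO i)"
    and PG_sampling: "\<And>i. i < nOm \<Longrightarrow> sampling_mat (nG i) n (PG i)"
    and PR_orth: "\<And>i j. i < nOm \<Longrightarrow> j < nOm \<Longrightarrow> i \<noteq> j \<Longrightarrow>
      PR i * (PR j)\<^sup>T = 0\<^sub>m (nR i) (nR j)"
    and PO_orth: "\<And>i j. i < nOm \<Longrightarrow> j < nOm \<Longrightarrow> i \<noteq> j \<Longrightarrow>
      PO i * (PO j)\<^sup>T = 0\<^sub>m (nO i) (nO j)"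
    and sum_nR: "(\<Sum>i<nOm. nR i) = n"
    and rs_dim: "\<And>i u v. i < nOm \<Longrightarrow> u \<in> carrier_vec (nO i) \<Longrightarrow> v \<in> carrier_vec (nG i) \<Longrightarrow>
      rs i u v \<in> carrier_vec (nR i)"
    and residual: "\<And>w. w \<in> carrier_vec n \<Longrightarrow>
      r w = finsum_vec TYPE(real) n (\<lambda>i. (PR i)\<^sup>T *\<^sub>v rs i (PO i *\<^sub>v w) (PG i *\<^sub>v w)) {..<nOm}"

text \<open>
  Port \<open>j\<close> consists of \<open>nP j\<close> degrees of freedom shared by the subdomains in \<open>subs j\<close>;
  \<open>PL i j\<close> extracts them from the interface state of subdomain \<open>i\<close>, and \<open>PP j\<close> from the
  global state.
\<close>

definition ports_of :: "nat \<Rightarrow> (nat \<Rightarrow> nat set) \<Rightarrow> nat \<Rightarrow> nat set" where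
  "ports_of np subs i = {j. j < np \<and> i \<in> subs j}"

locale dd_ports = dd_system n nOm nR nO nG r rs PR PO PG
  for n nOm :: nat
    and nR nO nG :: "nat \<Rightarrow> nat"
    and r :: "real vec \<Rightarrow> real vec"
    and rs :: "nat \<Rightarrow> real vec \<Rightarrow> real vec \<Rightarrow> real vec"
    and PR PO PG :: "nat \<Rightarrow> real mat" +
  fixes np :: nat
    and nP :: "nat \<Rightarrow> nat"
    and subs :: "nat \<Rightarrow> nat set"
    and PL :: "nat \<Rightarrow> nat \<Rightarrow> real mat"
    and PP :: "nat \<Rightarrow> real mat"
  assumes subs: "\<And>j. j < np \<Longrightarrow> subs j \<subseteq> {..<nOm}"
    and PL_sampling: "\<And>i j. j < np \<Longrightarrow> i \<in> subs j \<Longrightarrow> sampling_mat (nP j) (nG i) (PL i j)"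
    and PP_sampling: "\<And>j. j < np \<Longrightarrow> sampling_mat (nP j) n (PP j)"
    and PL_PG: "\<And>i j. j < np \<Longrightarrow> i \<in> subs j \<Longrightarrow> PL i j * PG i = PP j"
    and PL_orth: "\<And>i j l. i < nOm \<Longrightarrow> j \<in> ports_of np subs i \<Longrightarrow> l \<in> ports_of np subs i \<Longrightarrow>
      j \<noteq> l \<Longrightarrow> PL i j * (PL i l)\<^sup>T = 0\<^sub>m (nP j) (nP l)"
    and sum_nP: "\<And>i. i < nOm \<Longrightarrow> (\<Sum>j \<in> ports_of np subs i. nP j) = nG i"
    and segments_disjoint:
      "disjoint_family_on (case_sum (\<lambda>i. sampled (PO i)) (\<lambda>j. sampled (PP j)))
         ({..<nOm} <+> {..<np})"
    and segments_cover:
      "(\<Union>i<nOm. sampled (PO i)) \<union> (\<Union>j<np. sampled (PP j)) = {..<n}"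

text \<open>The row count \<open>nAb\<close> is given over the integers to avoid truncated subtraction.\<close>

locale dd_strong = dd_ports n nOm nR nO nG r rs PR PO PG np nP subs PL PP
  for n nOm :: nat
    and nR nO nG :: "nat \<Rightarrow> nat"
    and r :: "real vec \<Rightarrow> real vec"
    and rs :: "nat \<Rightarrow> real vec \<Rightarrow> real vec \<Rightarrow> real vec"
    and PR PO PG :: "nat \<Rightarrow> real mat"
    and np :: nat
    and nP :: "nat \<Rightarrow> nat"
    and subs :: "nat \<Rightarrow> nat set"
    and PL :: "nat \<Rightarrow> nat \<Rightarrow> real mat"
    and PP :: "nat \<Rightarrow> real mat" +
  fixes nAb :: nat
    and Ab :: "nat \<Rightarrow> real mat"
  assumes nAb: "int nAb = (\<Sum>j<np. (int (card (subs j)) - 1) * int (nP j))"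
    and Ab_dim: "\<And>i. i < nOm \<Longrightarrow> Ab i \<in> carrier_mat nAb (nG i)"
    and Ab_entries: "\<And>i. i < nOm \<Longrightarrow> elements_mat (Ab i) \<subseteq> {-1, 0, 1}"
    and Ab_compat: "\<And>y. (\<And>i. i < nOm \<Longrightarrow> y i \<in> carrier_vec (nG i)) \<Longrightarrow>
      finsum_vec TYPE(real) nAb (\<lambda>i. Ab i *\<^sub>v y i) {..<nOm} = 0\<^sub>v nAb \<longleftrightarrow>
      (\<forall>j<np. \<forall>i\<in>subs j. \<forall>l\<in>subs j. PL i j *\<^sub>v y i = PL l j *\<^sub>v y l)"

definition full_col_rank :: "nat \<Rightarrow> nat \<Rightarrow> real mat \<Rightarrow> bool" where
  "full_col_rank m p M \<longleftrightarrow> M \<in> carrier_mat m p \<and> vec_space.rank m M = p"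

definition ib_bases ::
  "nat \<Rightarrow> (nat \<Rightarrow> nat) \<Rightarrow> (nat \<Rightarrow> nat) \<Rightarrow> (nat \<Rightarrow> nat) \<Rightarrow> (nat \<Rightarrow> nat) \<Rightarrow>
   (nat \<Rightarrow> real mat) \<Rightarrow> (nat \<Rightarrow> real mat) \<Rightarrow> bool" where
  "ib_bases nOm nO nG pO pG PhiO PhiG \<longleftrightarrow>
     (\<forall>i<nOm. full_col_rank (nO i) (pO i) (PhiO i) \<and> full_col_rank (nG i) (pG i) (PhiG i))"

text \<open>The interior rows of \<open>Phi i\<close> come first, followed by the interface rows.\<close>

definition full_bases ::
  "nat \<Rightarrow> (nat \<Rightarrow> nat) \<Rightarrow> (nat \<Rightarrow> nat) \<Rightarrow> (nat \<Rightarrow> nat) \<Rightarrow>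
   (nat \<Rightarrow> real mat) \<Rightarrow> (nat \<Rightarrow> real mat) \<Rightarrow> (nat \<Rightarrow> real mat) \<Rightarrow> bool" where
  "full_bases nOm nO nG p Phi PhiO PhiG \<longleftrightarrow>
     (\<forall>i<nOm. full_col_rank (nO i + nG i) (p i) (Phi i) \<and>
        PhiO i \<in> carrier_mat (nO i) (p i) \<and> PhiG i \<in> carrier_mat (nG i) (p i) \<and>
        Phi i = PhiO i @\<^sub>r PhiG i)"

definition rom_objective ::
  "nat \<Rightarrow> (nat \<Rightarrow> real mat) \<Rightarrow> (nat \<Rightarrow> real vec \<Rightarrow> real vec \<Rightarrow> real vec) \<Rightarrow>
   (nat \<Rightarrow> real mat) \<Rightarrow> (nat \<Rightarrow> real mat) \<Rightarrow> (nat \<Rightarrow> real vec) \<Rightarrow> (nat \<Rightarrow> real vec) \<Rightarrow> real" where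
  "rom_objective nOm B rs PhiO PhiG wO wG =
     1 / 2 * (\<Sum>i<nOm. (norm2 (B i *\<^sub>v rs i (PhiO i *\<^sub>v wO i) (PhiG i *\<^sub>v wG i)))\<^sup>2)"

definition rom_constraint ::
  "nat \<Rightarrow> nat \<Rightarrow> (nat \<Rightarrow> real mat) \<Rightarrow> (nat \<Rightarrow> real mat) \<Rightarrow> (nat \<Rightarrow> real vec) \<Rightarrow> bool" where
  "rom_constraint nOm nA A PhiG wG \<longleftrightarrow>
     finsum_vec TYPE(real) nA (\<lambda>i. A i *\<^sub>v (PhiG i *\<^sub>v wG i)) {..<nOm} = 0\<^sub>v nA"

definition ib_rom_solution where
  "ib_rom_solution nOm B rs nA A pO pG PhiO PhiG xO xG \<longleftrightarrow>
     is_arg_min (\<lambda>(wO, wG). rom_objective nOm B rs PhiO PhiG wO wG)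
       (\<lambda>(wO, wG). (\<forall>i<nOm. wO i \<in> carrier_vec (pO i) \<and> wG i \<in> carrier_vec (pG i)) \<and>
          rom_constraint nOm nA A PhiG wG)
       (xO, xG)"

definition full_rom_solution where
  "full_rom_solution nOm B rs nA A p PhiO PhiG xh \<longleftrightarrow>
     is_arg_min (\<lambda>w. rom_objective nOm B rs PhiO PhiG w w)
       (\<lambda>w. (\<forall>i<nOm. w i \<in> carrier_vec (p i)) \<and> rom_constraint nOm nA A PhiG w)
       xh"

definition ib_global_solution where
  "ib_global_solution n nOm B rs nA A pO pG PhiO PhiG PO PG xt \<longleftrightarrow>
     xt \<in> carrier_vec n \<and>
     (\<exists>xO xG. ib_rom_solution nOm B rs nA A pO pG PhiO PhiG xO xG \<and>
        (\<forall>i<nOm. PO i *\<^sub>v xt = PhiO i *\<^sub>v xO i \<and> PG i *\<^sub>v xt = PhiG i *\<^sub>v xG i))"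

definition full_global_solution where
  "full_global_solution n nOm B rs nA A p PhiO PhiG PO PG xt \<longleftrightarrow>
     xt \<in> carrier_vec n \<and>
     (\<exists>xh. full_rom_solution nOm B rs nA A p PhiO PhiG xh \<and>
        (\<forall>i<nOm. PO i *\<^sub>v xt = PhiO i *\<^sub>v xh i \<and> PG i *\<^sub>v xt = PhiG i *\<^sub>v xh i))"

text \<open>The matrix \<open>[Ab 0 * PhiG 0, \<dots>, Ab (nOm - 1) * PhiG (nOm - 1)]\<close>.\<close>

definition constraint_mat ::
  "nat \<Rightarrow> nat \<Rightarrow> (nat \<Rightarrow> real mat) \<Rightarrow> (nat \<Rightarrow> real mat) \<Rightarrow> real mat" where
  "constraint_mat nOm nAb Ab PhiG =
     mat_of_cols nAb (concat (map (\<lambda>i. cols (Ab i * PhiG i)) [0..<nOm]))"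

definition null_space_basis :: "nat \<Rightarrow> nat \<Rightarrow> nat \<Rightarrow> real mat \<Rightarrow> real mat \<Rightarrow> bool" where
  "null_space_basis nr nc q M N \<longleftrightarrow>
     q = nc - vec_space.rank nr M \<and> N \<in> carrier_mat nc q \<and> distinct (cols N) \<and>
     kernel.basis nc M (set (cols N))"

text \<open>The \<open>i\<close>th row block of \<open>N\<close>, where the successive blocks have \<open>p 0, p 1, \<dots>\<close> rows.\<close>

definition row_block :: "(nat \<Rightarrow> nat) \<Rightarrow> real mat \<Rightarrow> nat \<Rightarrow> real mat" where
  "row_block p N i = mat (p i) (dim_col N) (\<lambda>(a, b). N $$ ((\<Sum>k<i. p k) + a, b))"

definition trial_IB where
  "trial_IB n nOm PO PG pO pG PhiO PhiG q N =
     {w \<in> carrier_vec n. \<exists>wO. \<exists>wn \<in> carrier_vec q. \<forall>i<nOm.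
        wO i \<in> carrier_vec (pO i) \<and>
        PO i *\<^sub>v w = PhiO i *\<^sub>v wO i \<and>
        PG i *\<^sub>v w = PhiG i *\<^sub>v (row_block pG N i *\<^sub>v wn)}"

definition trial_F where
  "trial_F n nOm PO PG p PhiO PhiG q N =
     {w \<in> carrier_vec n. \<exists>wn \<in> carrier_vec q. \<forall>i<nOm.
        PO i *\<^sub>v w = PhiO i *\<^sub>v (row_block p N i *\<^sub>v wn) \<and>
        PG i *\<^sub>v w = PhiG i *\<^sub>v (row_block p N i *\<^sub>v wn)}"

end

theory Submission
  imports Defs
begin

text \<open>
  The bound is an a posteriori estimate: the inverse Lipschitz condition turns the error into a
  difference of subdomain residuals, and the subdomain residuals of the full-order solution
  \<open>x\<close> are all zero. The latter holds because the scatter matrices \<open>(PR i)\<^sup>T\<close> put the subdomain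
  residuals into disjoint sets of entries of \<open>r x = 0\<close>, so that nothing can cancel
  (\<open>subdomain_residual_zero\<close>). Hence \<open>\<kappa> * norm2 (x - xt)\<close> is at most the norm of the subdomain
  residuals at \<open>xt\<close>, and the hypothesis on the matrices \<open>B i\<close> bounds this by the weighted residual,
  provided that \<open>xt\<close> lies in the trial subspace.

  Membership in the trial subspace is a matter of feasibility. The interface coordinates of the
  reduced solution, stacked on top of each other, form a vector in the null space of the
  constraint matrix \<open>[Ab 0 * PhiG 0, \<dots>]\<close>, because multiplying by this matrix evaluates the left
  side of the constraint (\<open>constraint_mat_mult_stack_vec\<close>). The stacked vector is therefore a
  combination of the columns of the null space basis \<open>N\<close>, and the row blocks of \<open>N\<close> recover the
  coordinates of each subdomain with the same coefficients
  (\<open>rom_constraint_null_coordinates\<close>).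

  The lower bound holds because sampling keeps some of the entries of a vector, each at most once,
  and so cannot increase its Euclidean norm (\<open>norm2_sampling_le\<close>).
\<close>

section \<open>Sampling matrices\<close>

lemma sampling_mat_carrier: "sampling_mat m n M \<Longrightarrow> M \<in> carrier_mat m n"
  by (auto simp: sampling_mat_def)

text \<open>The rows are distinct unit vectors, hence orthonormal.\<close>

lemma sampling_mat_mult_transpose:
  assumes "sampling_mat m n M"
  shows "M * M\<^sup>T = 1\<^sub>m m"
proof -
  obtain s where inj: "inj_on s {..<m}" and s: "s ` {..<m} \<subseteq> {..<n}"
    and M: "M = mat\<^sub>r m n (\<lambda>k. row (1\<^sub>m n) (s k))"
    using assms by (auto simp: sampling_mat_def)
  have r: "row M k = unit_vec n (s k)" if "k < m" for k
    using that s by (auto simp: M)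
  have rr: "row M a \<bullet> row M b = (if a = b then 1 else 0)" if "a < m" "b < m" for a b
    using that s inj by (auto simp: r inj_on_eq_iff image_subset_iff)
  have d: "dim_row M = m" by (simp add: M)
  show ?thesis
  proof (rule eq_matI)
    fix a b assume "a < dim_row (1\<^sub>m m :: real mat)" "b < dim_col (1\<^sub>m m :: real mat)"
    then have ab: "a < m" "b < m" by simp_all
    then have "(M * M\<^sup>T) $$ (a, b) = row M a \<bullet> row M b" using d by simp
    then show "(M * M\<^sup>T) $$ (a, b) = 1\<^sub>m m $$ (a, b)" using ab by (simp add: rr)
  qed (simp_all add: d)
qed

lemma sampling_mat_mult_vec_index:
  assumes "sampling_mat m n M" and "v \<in> carrier_vec n"
  obtains s where "inj_on s {..<m}" "s ` {..<m} \<subseteq> {..<n}" "\<And>k. k < m \<Longrightarrow> (M *\<^sub>v v) $ k = v $ s k"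
proof -
  obtain s where s: "inj_on s {..<m}" "s ` {..<m} \<subseteq> {..<n}"
    and M: "M = mat\<^sub>r m n (\<lambda>k. row (1\<^sub>m n) (s k))"
    using assms by (auto simp: sampling_mat_def)
  have "(M *\<^sub>v v) $ k = v $ s k" if "k < m" for k
    using that s assms(2) by (auto simp: M image_subset_iff)
  then show thesis using that s by blast
qed

lemma norm2_nonneg: "0 \<le> norm2 v"
  by (simp add: norm2_def L2_set_nonneg)

lemma norm2_minus_commute:
  assumes "u \<in> carrier_vec n" "v \<in> carrier_vec n"
  shows "norm2 (u - v) = norm2 (v - u)"
proof -
  have "((u - v) $ k)\<^sup>2 = ((v - u) $ k)\<^sup>2" if "k < n" for k
    using assms that by (simp add: power2_commute[of "u $ k" "v $ k"])
  then show ?thesis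
    using assms by (simp add: norm2_def L2_set_def del: index_minus_vec(1))
qed

text \<open>
  The squared norm on the left is a subsum of the one on the right: injectivity of the selection
  ensures that no entry is counted twice.
\<close>

lemma norm2_sampling_le:
  assumes M: "sampling_mat m n M" and u: "u \<in> carrier_vec n" and v: "v \<in> carrier_vec n"
  shows "norm2 (M *\<^sub>v u - M *\<^sub>v v) \<le> norm2 (u - v)"
proof -
  have Mc: "M \<in> carrier_mat m n" using M by (rule sampling_mat_carrier)
  have d: "u - v \<in> carrier_vec n" using u v by simp
  from sampling_mat_mult_vec_index[OF M d]
  obtain s where inj: "inj_on s {..<m}" and s: "s ` {..<m} \<subseteq> {..<n}"
    and idx: "\<And>k. k < m \<Longrightarrow> (M *\<^sub>v (u - v)) $ k = (u - v) $ s k" by blast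
  have "(\<Sum>k<m. ((u - v) $ s k)\<^sup>2) = (\<Sum>l\<in>s ` {..<m}. ((u - v) $ l)\<^sup>2)"
    by (simp add: sum.reindex[OF inj] o_def)
  also have "\<dots> \<le> (\<Sum>l<n. ((u - v) $ l)\<^sup>2)"
    using s by (intro sum_mono2) auto
  finally have "norm2 (M *\<^sub>v (u - v)) \<le> norm2 (u - v)"
    using Mc carrier_vecD[OF d] idx
    by (simp add: norm2_def L2_set_def del: index_mult_mat_vec index_minus_vec)
  then show ?thesis
    by (simp add: mult_minus_distrib_mat_vec[OF Mc u v])
qed

text \<open>The bound must be nonnegative since \<open>fin_max\<close> takes the value 0 on the empty index set.\<close>

lemma fin_max_le:
  assumes "finite I" "\<And>i. i \<in> I \<Longrightarrow> f i \<le> c" "0 \<le> c"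
  shows "fin_max I f \<le> c"
  using assms by (auto simp: fin_max_def)

section \<open>Vanishing of the subdomain residuals\<close>

text \<open>
  Applying \<open>PR j\<close> to the assembled residual leaves only the contribution of subdomain \<open>j\<close>:
  \<open>PR j * (PR i)\<^sup>T\<close> is the identity for \<open>i = j\<close> and zero otherwise.
\<close>

lemma (in dd_system) subdomain_residual_zero:
  assumes w: "w \<in> carrier_vec n" and rw: "r w = 0\<^sub>v n" and j: "j < nOm"
  shows "rs j (PO j *\<^sub>v w) (PG j *\<^sub>v w) = 0\<^sub>v (nR j)"
proof -
  define v where "v i = rs i (PO i *\<^sub>v w) (PG i *\<^sub>v w)" for i
  interpret V: vec_space "TYPE(real)" n .
  have PRc: "PR i \<in> carrier_mat (nR i) n" if "i < nOm" for i
    using PR_sampling[OF that] by (rule sampling_mat_carrier)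
  have vc: "v i \<in> carrier_vec (nR i)" if "i < nOm" for i
    unfolding v_def using that w PO_sampling[OF that] PG_sampling[OF that]
    by (intro rs_dim) (auto dest: sampling_mat_carrier)
  have term_c: "(\<lambda>i. (PR i)\<^sup>T *\<^sub>v v i) \<in> {..<nOm} \<rightarrow> carrier_vec n"
    using PRc by (auto intro!: mult_mat_vec_carrier vc)
  have prod: "PR j *\<^sub>v ((PR i)\<^sup>T *\<^sub>v v i) = (if i = j then v j else 0\<^sub>v (nR j))" if i: "i < nOm" for i
  proof -
    have "PR j *\<^sub>v ((PR i)\<^sup>T *\<^sub>v v i) = (PR j * (PR i)\<^sup>T) *\<^sub>v v i"
      using PRc[OF j] PRc[OF i] vc[OF i] by (intro assoc_mult_mat_vec[symmetric]) auto
    then show ?thesis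
      using PR_orth[OF j i] sampling_mat_mult_transpose[OF PR_sampling[OF j]] vc[OF i] vc[OF j]
      by auto
  qed
  \<comment> \<open>Entry \<open>k\<close> of \<open>PR j\<close> times the assembled residual is a scalar product with a row, and scalar
    products distribute over the sum of the subdomain contributions.\<close>
  have "v j $ k = 0" if k: "k < nR j" for k
  proof -
    have rowc: "row (PR j) k \<in> carrier_vec n" using PRc[OF j] k by auto
    have "0 = 0\<^sub>v n \<bullet> row (PR j) k" using rowc by simp
    also have "0\<^sub>v n = finsum V.V (\<lambda>i. (PR i)\<^sup>T *\<^sub>v v i) {..<nOm}"
      using residual[OF w] rw unfolding v_def by simp
    also have "\<dots> \<bullet> row (PR j) k = (\<Sum>i<nOm. ((PR i)\<^sup>T *\<^sub>v v i) \<bullet> row (PR j) k)"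
      by (rule V.finsum_scalar_prod_sum[OF term_c rowc])
    also have "\<dots> = (\<Sum>i<nOm. (PR j *\<^sub>v ((PR i)\<^sup>T *\<^sub>v v i)) $ k)"
    proof (rule sum.cong[OF refl])
      fix i assume "i \<in> {..<nOm}"
      then have "(PR i)\<^sup>T *\<^sub>v v i \<in> carrier_vec n" using term_c by blast
      then show "((PR i)\<^sup>T *\<^sub>v v i) \<bullet> row (PR j) k = (PR j *\<^sub>v ((PR i)\<^sup>T *\<^sub>v v i)) $ k"
        using PRc[OF j] k rowc by (simp add: comm_scalar_prod[of _ n])
    qed
    also have "\<dots> = (\<Sum>i<nOm. if i = j then v j $ k else 0)"
      using k by (intro sum.cong) (auto simp: prod)
    also have "\<dots> = v j $ k" using j by simp
    finally show ?thesis by simp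
  qed
  then show ?thesis using vc[OF j] unfolding v_def by (intro eq_vecI) auto
qed

section \<open>Null space parametrization of the constraint\<close>

primrec stack_vec :: "(nat \<Rightarrow> real vec) \<Rightarrow> nat \<Rightarrow> real vec" where
  "stack_vec w 0 = vNil"
| "stack_vec w (Suc m) = stack_vec w m @\<^sub>v w m"

lemma stack_vec_carrier:
  assumes "\<And>i. i < m \<Longrightarrow> w i \<in> carrier_vec (p i)"
  shows "stack_vec w m \<in> carrier_vec (\<Sum>i<m. p i)"
  using assms by (induction m) auto

text \<open>
  Block \<open>i\<close> starts at the offset \<open>\<Sum>k<i. p k\<close> at which \<open>row_block\<close> cuts out the rows of a matrix.
\<close>

lemma stack_vec_index:
  assumes "\<And>i. i < m \<Longrightarrow> w i \<in> carrier_vec (p i)" and "i < m" "a < p i"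
  shows "stack_vec w m $ ((\<Sum>k<i. p k) + a) = w i $ a"
  using assms
proof (induction m)
  case (Suc m)
  have c: "stack_vec w m \<in> carrier_vec (\<Sum>i<m. p i)"
    using Suc.prems(1) by (intro stack_vec_carrier) auto
  show ?case
  proof (cases "i = m")
    case True
    then show ?thesis using Suc.prems(1)[of m] Suc.prems(3) c by auto
  next
    case False
    then have i: "i < m" using Suc.prems(2) by simp
    have "(\<Sum>k<i. p k) + a < (\<Sum>k<Suc i. p k)" using Suc.prems(3) by simp
    also have "\<dots> \<le> (\<Sum>k<m. p k)" using i by (intro sum_mono2) auto
    finally show ?thesis using Suc.IH[OF _ i] Suc.prems c by auto
  qed
qed simp

lemma row_block_mult_vec:
  assumes N: "N \<in> carrier_mat (\<Sum>i<m. p i) q" and c: "c \<in> carrier_vec q"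
    and w: "\<And>i. i < m \<Longrightarrow> w i \<in> carrier_vec (p i)"
    and stack: "N *\<^sub>v c = stack_vec w m" and i: "i < m"
  shows "row_block p N i *\<^sub>v c = w i"
proof (rule eq_vecI)
  fix a assume "a < dim_vec (w i)"
  then have a: "a < p i" using w[OF i] by auto
  have "(\<Sum>k<i. p k) + a < (\<Sum>k<Suc i. p k)" using a by simp
  also have "\<dots> \<le> (\<Sum>k<m. p k)" using i by (intro sum_mono2) auto
  finally have l: "(\<Sum>k<i. p k) + a < (\<Sum>k<m. p k)" .
  have "(row_block p N i *\<^sub>v c) $ a = (N *\<^sub>v c) $ ((\<Sum>k<i. p k) + a)"
    using a l N c by (auto simp: row_block_def scalar_prod_def)
  also have "\<dots> = w i $ a"
    unfolding stack using w i a by (rule stack_vec_index)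
  finally show "(row_block p N i *\<^sub>v c) $ a = w i $ a" .
qed (use w[OF i] in \<open>auto simp: row_block_def\<close>)

lemma mat_of_cols_append_mult_vec:
  assumes u: "u \<in> carrier_vec (length xs)" and v: "v \<in> carrier_vec (length ys)"
  shows "mat_of_cols n (xs @ ys) *\<^sub>v (u @\<^sub>v v) = mat_of_cols n xs *\<^sub>v u + mat_of_cols n ys *\<^sub>v v"
proof (rule eq_vecI)
  fix i assume "i < dim_vec (mat_of_cols n xs *\<^sub>v u + mat_of_cols n ys *\<^sub>v v)"
  then have i: "i < n" by simp
  have "row (mat_of_cols n (xs @ ys)) i = row (mat_of_cols n xs) i @\<^sub>v row (mat_of_cols n ys) i"
    using i by (intro eq_vecI) (auto simp: mat_of_cols_def nth_append)
  moreover have "row (mat_of_cols n xs) i \<in> carrier_vec (length xs)"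
    "row (mat_of_cols n ys) i \<in> carrier_vec (length ys)"
    using i by (auto intro!: row_carrier_vec)
  ultimately show "(mat_of_cols n (xs @ ys) *\<^sub>v (u @\<^sub>v v)) $ i =
      (mat_of_cols n xs *\<^sub>v u + mat_of_cols n ys *\<^sub>v v) $ i"
    using i scalar_prod_append[of "row (mat_of_cols n xs) i" "length xs"
        "row (mat_of_cols n ys) i" "length ys" u v] u v
    by simp
qed simp

lemma length_constraint_cols:
  assumes "\<And>i. i < m \<Longrightarrow> Phi i \<in> carrier_mat (g i) (p i)"
  shows "length (concat (map (\<lambda>i. cols (Ab i * Phi i)) [0..<m])) = (\<Sum>i<m. p i)"
  using assms by (induction m) auto

lemma constraint_mat_carrier:
  assumes "\<And>i. i < m \<Longrightarrow> Phi i \<in> carrier_mat (g i) (p i)"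
  shows "constraint_mat m nA Ab Phi \<in> carrier_mat nA (\<Sum>i<m. p i)"
proof -
  have "length (concat (map (\<lambda>i. cols (Ab i * Phi i)) [0..<m])) = (\<Sum>i<m. p i)"
    using assms by (rule length_constraint_cols)
  then show ?thesis
    unfolding constraint_mat_def by (metis mat_of_cols_carrier(1))
qed

text \<open>
  This connects the column blocks of the constraint matrix with the constraint itself: its product
  with the stacked reduced interface states is the sum that the constraint sets to zero. The
  induction splits off the last block.
\<close>

lemma constraint_mat_mult_stack_vec:
  assumes "\<And>i. i < m \<Longrightarrow> Ab i \<in> carrier_mat nA (g i)"
    and "\<And>i. i < m \<Longrightarrow> Phi i \<in> carrier_mat (g i) (p i)"
    and "\<And>i. i < m \<Longrightarrow> w i \<in> carrier_vec (p i)"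
  shows "constraint_mat m nA Ab Phi *\<^sub>v stack_vec w m =
    finsum_vec TYPE(real) nA (\<lambda>i. Ab i *\<^sub>v (Phi i *\<^sub>v w i)) {..<m}"
  using assms
proof (induction m)
  case 0
  show ?case by (auto simp: constraint_mat_def finsum_vec_empty scalar_prod_def)
next
  case (Suc m)
  let ?C = "concat (map (\<lambda>i. cols (Ab i * Phi i)) [0..<m])"
  have len: "length ?C = (\<Sum>i<m. p i)"
    by (rule length_constraint_cols[where g = g]) (simp add: Suc.prems(2))
  have A: "Ab m \<in> carrier_mat nA (g m)" and Ph: "Phi m \<in> carrier_mat (g m) (p m)"
    and wm: "w m \<in> carrier_vec (p m)" using Suc.prems by auto
  have terms: "Ab i *\<^sub>v (Phi i *\<^sub>v w i) \<in> carrier_vec nA" if "i < Suc m" for i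
    using Suc.prems(1)[OF that] Suc.prems(2)[OF that] Suc.prems(3)[OF that]
    by (metis mult_mat_vec_carrier)
  have stack: "stack_vec w m \<in> carrier_vec (length ?C)"
    unfolding len by (rule stack_vec_carrier) (simp add: Suc.prems(3))
  have wm': "w m \<in> carrier_vec (length (cols (Ab m * Phi m)))"
    using Ph wm by simp
  have "constraint_mat (Suc m) nA Ab Phi *\<^sub>v stack_vec w (Suc m) =
      mat_of_cols nA ?C *\<^sub>v stack_vec w m + mat_of_cols nA (cols (Ab m * Phi m)) *\<^sub>v w m"
    using mat_of_cols_append_mult_vec[OF stack wm', of nA] by (simp add: constraint_mat_def)
  also have "mat_of_cols nA ?C *\<^sub>v stack_vec w m =
      finsum_vec TYPE(real) nA (\<lambda>i. Ab i *\<^sub>v (Phi i *\<^sub>v w i)) {..<m}"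
    using Suc.IH Suc.prems by (simp add: constraint_mat_def)
  also have "mat_of_cols nA (cols (Ab m * Phi m)) = Ab m * Phi m"
    using mat_of_cols_cols[of "Ab m * Phi m"] A by simp
  also have "(Ab m * Phi m) *\<^sub>v w m = Ab m *\<^sub>v (Phi m *\<^sub>v w m)"
    using A Ph wm by (rule assoc_mult_mat_vec)
  also have "finsum_vec TYPE(real) nA (\<lambda>i. Ab i *\<^sub>v (Phi i *\<^sub>v w i)) {..<m} + Ab m *\<^sub>v (Phi m *\<^sub>v w m) =
      Ab m *\<^sub>v (Phi m *\<^sub>v w m) + finsum_vec TYPE(real) nA (\<lambda>i. Ab i *\<^sub>v (Phi i *\<^sub>v w i)) {..<m}"
    by (rule comm_add_vec[of _ nA]) (use terms in \<open>auto intro!: finsum_vec_closed\<close>)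
  also have "\<dots> = finsum_vec TYPE(real) nA (\<lambda>i. Ab i *\<^sub>v (Phi i *\<^sub>v w i)) {..<Suc m}"
    unfolding lessThan_Suc
    by (rule finsum_vec_insert[symmetric]) (use terms in auto)
  finally show ?case .
qed

text \<open>
  The spans in the kernel and in the whole space are those of two different module structures; they
  agree on subsets of the kernel, which identifies the null space with the column space of \<open>N\<close>.
\<close>

lemma null_space_basis_obtain:
  assumes basis: "null_space_basis nr nc q M N" and M: "M \<in> carrier_mat nr nc"
    and u: "u \<in> carrier_vec nc" and Mu: "M *\<^sub>v u = 0\<^sub>v nr"
  obtains c where "c \<in> carrier_vec q" "N *\<^sub>v c = u"
proof -
  interpret K: kernel nr nc M by unfold_locales (rule M)
  have N: "N \<in> carrier_mat nc q" and b: "K.basis (set (cols N))"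
    using basis unfolding null_space_basis_def by blast+
  have "set (cols N) \<subseteq> mat_kernel M \<and> K.span (set (cols N)) = mat_kernel M"
    using b unfolding K.Ker.basis_def by blast
  then have ker: "set (cols N) \<subseteq> mat_kernel M" and gen: "K.span (set (cols N)) = mat_kernel M"
    by blast+
  have "K.NC.col_space N = mat_kernel M"
    unfolding K.NC.col_space_def by (rule trans[OF K.span_same[OF ker, symmetric] gen])
  then have "u \<in> K.NC.col_space N"
    by (rule ssubst) (rule mat_kernelI[OF M u Mu])
  then show thesis
    using that N unfolding K.NC.col_space_eq[OF N] by auto
qed

text \<open>
  A feasible choice of reduced interface states is parametrized by one coefficient vector that is
  common to all subdomains. This is the form in which the trial subspaces are defined.
\<close>

lemma rom_constraint_null_coordinates:
  assumes N: "null_space_basis nA (\<Sum>i<m. p i) q (constraint_mat m nA Ab Phi) N"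
    and Ab: "\<And>i. i < m \<Longrightarrow> Ab i \<in> carrier_mat nA (g i)"
    and Phi: "\<And>i. i < m \<Longrightarrow> Phi i \<in> carrier_mat (g i) (p i)"
    and w: "\<And>i. i < m \<Longrightarrow> w i \<in> carrier_vec (p i)"
    and con: "rom_constraint m nA Ab Phi w"
  obtains c where "c \<in> carrier_vec q" "\<And>i. i < m \<Longrightarrow> row_block p N i *\<^sub>v c = w i"
proof -
  have "constraint_mat m nA Ab Phi *\<^sub>v stack_vec w m = 0\<^sub>v nA"
    using constraint_mat_mult_stack_vec[OF Ab Phi w] con by (simp add: rom_constraint_def)
  with null_space_basis_obtain[OF N constraint_mat_carrier[OF Phi] stack_vec_carrier[OF w]]
  obtain c where c: "c \<in> carrier_vec q" "N *\<^sub>v c = stack_vec w m" by blast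
  have "N \<in> carrier_mat (\<Sum>i<m. p i) q" using N unfolding null_space_basis_def by blast
  from row_block_mult_vec[OF this c(1) w c(2)] show thesis using that c(1) by blast
qed

text \<open>
  Equal constraint matrices have equally many rows as soon as there is a subdomain. Without
  subdomains \<open>nA\<close> and \<open>nAb\<close> may differ, but then both constraints are empty sums.
\<close>

lemma rom_constraint_cong:
  assumes con: "rom_constraint m nA A Phi w"
    and A: "\<And>i. i < m \<Longrightarrow> A i \<in> carrier_mat nA (g i)"
    and Ab: "\<And>i. i < m \<Longrightarrow> Ab i \<in> carrier_mat nAb (g i)"
    and eq: "\<And>i. i < m \<Longrightarrow> A i = Ab i"
    and Phi: "\<And>i. i < m \<Longrightarrow> Phi i \<in> carrier_mat (g i) (p i)"
    and w: "\<And>i. i < m \<Longrightarrow> w i \<in> carrier_vec (p i)"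
  shows "rom_constraint m nAb Ab Phi w"
proof (cases "m = 0")
  case True
  then show ?thesis by (simp add: rom_constraint_def finsum_vec_empty)
next
  case False
  then have "nA = nAb" using A[of 0] Ab[of 0] eq[of 0] by auto
  have mat_eq: "constraint_mat m nA A Phi = constraint_mat m nA Ab Phi"
    using eq by (auto simp: constraint_mat_def intro!: arg_cong[of _ _ "\<lambda>l. mat_of_cols nA (concat l)"])
  have "finsum_vec TYPE(real) nA (\<lambda>i. Ab i *\<^sub>v (Phi i *\<^sub>v w i)) {..<m} =
      constraint_mat m nA Ab Phi *\<^sub>v stack_vec w m"
    by (rule constraint_mat_mult_stack_vec[OF Ab[folded \<open>nA = nAb\<close>] Phi w, symmetric])
  also have "\<dots> = finsum_vec TYPE(real) nA (\<lambda>i. A i *\<^sub>v (Phi i *\<^sub>v w i)) {..<m}"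
    unfolding mat_eq[symmetric] by (rule constraint_mat_mult_stack_vec[OF A Phi w])
  also have "\<dots> = 0\<^sub>v nA"
    using con unfolding rom_constraint_def .
  finally show ?thesis
    unfolding rom_constraint_def \<open>nA = nAb\<close> .
qed

theorem proposition1:
  fixes n nOm np nA nAb pnull :: nat
    and nR nO nG nP nB pO pG :: "nat \<Rightarrow> nat"
    and r :: "real vec \<Rightarrow> real vec"
    and rs :: "nat \<Rightarrow> real vec \<Rightarrow> real vec \<Rightarrow> real vec"
    and PR PO PG PP A Ab B Phi PhiO PhiG :: "nat \<Rightarrow> real mat"
    and subs :: "nat \<Rightarrow> nat set"
    and PL :: "nat \<Rightarrow> nat \<Rightarrow> real mat"
    and N :: "real mat"
    and S :: "real vec set"
    and \<kappa> P :: real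
    and x xt :: "real vec"
  assumes system: "dd_strong n nOm nR nO nG r rs PR PO PG np nP subs PL PP nAb Ab"
    and B_dim: "\<And>i. i < nOm \<Longrightarrow> B i \<in> carrier_mat (nB i) (nR i) \<and> nB i \<le> nR i"
    and A_dim: "\<And>i. i < nOm \<Longrightarrow> A i \<in> carrier_mat nA (nG i)"
    and null_basis: "null_space_basis nAb (\<Sum>i<nOm. pG i) pnull
                       (constraint_mat nOm nAb Ab PhiG) N"
    and bases:
      "ib_bases nOm nO nG pO pG PhiO PhiG \<and>
       S = trial_IB n nOm PO PG pO pG PhiO PhiG pnull N \<and>
       ib_global_solution n nOm B rs nA A pO pG PhiO PhiG PO PG xt
       \<or>
       full_bases nOm nO nG pG Phi PhiO PhiG \<and>
       S = trial_F n nOm PO PG pG PhiO PhiG pnull N \<and>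
       full_global_solution n nOm B rs nA A pG PhiO PhiG PO PG xt"
    and A1: "\<And>i. i < nOm \<Longrightarrow> A i = Ab i"
    and \<kappa>_pos: "\<kappa> > 0"
    and A2: "\<And>w y. w \<in> carrier_vec n \<Longrightarrow> y \<in> carrier_vec n \<Longrightarrow>
      sqrt (\<Sum>i<nOm. (norm2 (rs i (PO i *\<^sub>v w) (PG i *\<^sub>v w) - rs i (PO i *\<^sub>v y) (PG i *\<^sub>v y)))\<^sup>2)
        \<ge> \<kappa> * norm2 (w - y)"
    and P_pos: "P > 0"
    and A3: "\<And>w. w \<in> S \<Longrightarrow>
      sqrt (\<Sum>i<nOm. (norm2 (B i *\<^sub>v rs i (PO i *\<^sub>v w) (PG i *\<^sub>v w)))\<^sup>2)
        \<ge> P * sqrt (\<Sum>i<nOm. (norm2 (rs i (PO i *\<^sub>v w) (PG i *\<^sub>v w)))\<^sup>2)"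
    and x_dim: "x \<in> carrier_vec n"
    and x_solution: "r x = 0\<^sub>v n"
  shows "max (fin_max {..<nOm} (\<lambda>i. norm2 (PO i *\<^sub>v x - PO i *\<^sub>v xt)))
             (fin_max {..<np} (\<lambda>j. norm2 (PP j *\<^sub>v x - PP j *\<^sub>v xt)))
           \<le> norm2 (x - xt) \<and>
         norm2 (x - xt) \<le> 1 / (P * \<kappa>) *
           sqrt (\<Sum>i<nOm. (norm2 (B i *\<^sub>v rs i (PO i *\<^sub>v xt) (PG i *\<^sub>v xt)))\<^sup>2)"
proof -
  interpret dd_strong n nOm nR nO nG r rs PR PO PG np nP subs PL PP nAb Ab
    by (rule system)
  have xt: "xt \<in> carrier_vec n"
    using bases by (auto simp: ib_global_solution_def full_global_solution_def)
  have PhiG: "PhiG i \<in> carrier_mat (nG i) (pG i)" if "i < nOm" for i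
    using bases that by (auto simp: ib_bases_def full_bases_def full_col_rank_def)
  have coords: "\<exists>c \<in> carrier_vec pnull. \<forall>i<nOm. row_block pG N i *\<^sub>v c = w i"
    if w: "\<And>i. i < nOm \<Longrightarrow> w i \<in> carrier_vec (pG i)" and con: "rom_constraint nOm nA A PhiG w" for w
  proof -
    have "rom_constraint nOm nAb Ab PhiG w"
      using con A_dim Ab_dim A1 PhiG w by (rule rom_constraint_cong)
    from rom_constraint_null_coordinates[OF null_basis Ab_dim PhiG w this]
    show ?thesis by blast
  qed
  have xt_trial: "xt \<in> S"
    using bases
  proof (elim disjE conjE)
    assume S: "S = trial_IB n nOm PO PG pO pG PhiO PhiG pnull N"
      and "ib_global_solution n nOm B rs nA A pO pG PhiO PhiG PO PG xt"
    then obtain xO xG where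
      feas: "\<And>i. i < nOm \<Longrightarrow> xO i \<in> carrier_vec (pO i)" "\<And>i. i < nOm \<Longrightarrow> xG i \<in> carrier_vec (pG i)"
        "rom_constraint nOm nA A PhiG xG"
      and glue: "\<And>i. i < nOm \<Longrightarrow> PO i *\<^sub>v xt = PhiO i *\<^sub>v xO i \<and> PG i *\<^sub>v xt = PhiG i *\<^sub>v xG i"
      by (auto simp: ib_global_solution_def ib_rom_solution_def is_arg_min_def)
    from coords[OF feas(2,3)] obtain c
      where c: "c \<in> carrier_vec pnull" "\<forall>i<nOm. row_block pG N i *\<^sub>v c = xG i" by blast
    show ?thesis
      unfolding S trial_IB_def mem_Collect_eq
      by (intro conjI xt exI[of _ xO] bexI[OF _ c(1)]) (simp add: feas(1) glue c(2))
  next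
    assume S: "S = trial_F n nOm PO PG pG PhiO PhiG pnull N"
      and "full_global_solution n nOm B rs nA A pG PhiO PhiG PO PG xt"
    then obtain xh where
      feas: "\<And>i. i < nOm \<Longrightarrow> xh i \<in> carrier_vec (pG i)" "rom_constraint nOm nA A PhiG xh"
      and glue: "\<And>i. i < nOm \<Longrightarrow> PO i *\<^sub>v xt = PhiO i *\<^sub>v xh i \<and> PG i *\<^sub>v xt = PhiG i *\<^sub>v xh i"
      by (auto simp: full_global_solution_def full_rom_solution_def is_arg_min_def)
    from coords[OF feas] obtain c
      where c: "c \<in> carrier_vec pnull" "\<forall>i<nOm. row_block pG N i *\<^sub>v c = xh i" by blast
    show ?thesis
      unfolding S trial_F_def mem_Collect_eq
      by (intro conjI xt bexI[OF _ c(1)]) (simp add: glue c(2))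
  qed
  \<comment> \<open>The subdomain residuals at \<open>x\<close> are zero, so the differences in the inverse Lipschitz
    condition for \<open>xt\<close> and \<open>x\<close> are the residuals at \<open>xt\<close>.\<close>
  have diff: "rs i (PO i *\<^sub>v xt) (PG i *\<^sub>v xt) - rs i (PO i *\<^sub>v x) (PG i *\<^sub>v x) =
      rs i (PO i *\<^sub>v xt) (PG i *\<^sub>v xt)" if i: "i < nOm" for i
  proof -
    have "rs i (PO i *\<^sub>v xt) (PG i *\<^sub>v xt) \<in> carrier_vec (nR i)"
      using i xt PO_sampling[OF i] PG_sampling[OF i]
      by (intro rs_dim) (auto dest: sampling_mat_carrier)
    then show ?thesis
      by (simp add: subdomain_residual_zero[OF x_dim x_solution i])
  qed
  let ?R = "sqrt (\<Sum>i<nOm. (norm2 (rs i (PO i *\<^sub>v xt) (PG i *\<^sub>v xt)))\<^sup>2)"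
  let ?BR = "sqrt (\<Sum>i<nOm. (norm2 (B i *\<^sub>v rs i (PO i *\<^sub>v xt) (PG i *\<^sub>v xt)))\<^sup>2)"
  have "\<kappa> * norm2 (x - xt) \<le> ?R"
    using A2[OF xt x_dim] by (simp add: diff norm2_minus_commute[OF x_dim xt])
  then have "P * (\<kappa> * norm2 (x - xt)) \<le> P * ?R"
    using P_pos by simp
  also have "\<dots> \<le> ?BR"
    using A3[OF xt_trial] .
  finally have upper: "norm2 (x - xt) \<le> 1 / (P * \<kappa>) * ?BR"
    using P_pos \<kappa>_pos by (simp add: field_simps)
  have "fin_max {..<nOm} (\<lambda>i. norm2 (PO i *\<^sub>v x - PO i *\<^sub>v xt)) \<le> norm2 (x - xt)"
    by (rule fin_max_le) (auto intro: norm2_sampling_le[OF PO_sampling x_dim xt] norm2_nonneg)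
  moreover have "fin_max {..<np} (\<lambda>j. norm2 (PP j *\<^sub>v x - PP j *\<^sub>v xt)) \<le> norm2 (x - xt)"
    by (rule fin_max_le) (auto intro: norm2_sampling_le[OF PP_sampling x_dim xt] norm2_nonneg)
  ultimately show ?thesis
    using upper by simp
qed

end
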